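(* Let $t,q,s\ge 1$ and $k_i\ge 3$ $(1\le i\le t-1)$ be integers. The graph $K_1\vee (C_3\cup C_{k_1}\cup C_{k_2}\cup\cdots \cup C_{k_{t-1}}\cup qK_2\cup sK_1)$ is not DQS. Moreover, it is $Q$-cospectral with $K_1\vee (K_{1,3}\cup C_{k_1}\cup C_{k_2}\cup\cdots \cup C_{k_{t-1}}\cup qK_2\cup (s-1)K_1)$.
   Context: All graphs are finite, simple and undirected. $C_n$, $K_n$ denote the cycle and complete graph on $n$ vertices, $K_{1,3}$ the star with three leaves; $\cup$ is disjoint union, $rH$ is the disjoint union of $r$ copies of $H$ (with $0H$ the empty graph), and $\vee$ is the join (add all edges between the two graphs). For $t=1$ there are no cycles $C_{k_i}$. The signless Laplacian matrix of $G$ is $Q(G)=D(G)+A(G)$, where $D(G)$ is the diagonal matrix of vertex degrees and $A(G)$ the adjacency matrix. The $Q$-spectrum is the multiset of eigenvalues of $Q(G)$. Two graphs are $Q$-cospectral if they have the same $Q$-spectrum; $G$ is DQS if every graph $Q$-cospectral with $G$ is isomorphic to $G$. *)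

theory Defs
  imports
    "Graph_Theory.Graph_Theory"
    "Jordan_Normal_Form.Char_Poly"
    "HOL-Computational_Algebra.Fundamental_Theorem_Algebra"
begin

text \<open>
  A finite simple undirected graph is a \<open>pair_graph\<close> of Graph_Theory: a finite vertex set
  together with a symmetric, irreflexive relation on it, each edge \<open>uv\<close> being represented
  by the two arcs \<open>(u, v)\<close> and \<open>(v, u)\<close>.
\<close>

section \<open>Graphs\<close>

definition complete_graph :: "nat \<Rightarrow> nat pair_pre_digraph" where
  "complete_graph n = \<lparr> pverts = {..<n}, parcs = {(u, v). u < n \<and> v < n \<and> u \<noteq> v} \<rparr>"

definition complete_bipartite_graph :: "nat \<Rightarrow> nat \<Rightarrow> nat pair_pre_digraph" where
  "complete_bipartite_graph m n =
    \<lparr> pverts = {..<m + n},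
      parcs = {..<m} \<times> {m..<m + n} \<union> {m..<m + n} \<times> {..<m} \<rparr>"

text \<open>Only meaningful for \<open>n \<ge> 3\<close>.\<close>

definition cycle_graph :: "nat \<Rightarrow> nat pair_pre_digraph" where
  "cycle_graph n =
    \<lparr> pverts = {..<n},
      parcs = {(u, v). u < n \<and> v < n \<and> (v = Suc u mod n \<or> u = Suc v mod n)} \<rparr>"

text \<open>The vertex \<open>(i, v)\<close> is the copy of the vertex \<open>v\<close> of the \<open>i\<close>-th graph of the list.\<close>

definition disjoint_union :: "'a pair_pre_digraph list \<Rightarrow> (nat \<times> 'a) pair_pre_digraph" where
  "disjoint_union Gs =
    \<lparr> pverts = {(i, v). i < length Gs \<and> v \<in> pverts (Gs ! i)},
      parcs = {((i, u), (j, v)). i = j \<and> i < length Gs \<and> (u, v) \<in> parcs (Gs ! i)} \<rparr>"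

definition graph_join ::
    "'a pair_pre_digraph \<Rightarrow> 'b pair_pre_digraph \<Rightarrow> ('a + 'b) pair_pre_digraph" where
  "graph_join G H =
    \<lparr> pverts = pverts G <+> pverts H,
      parcs = {(Inl u, Inl v) | u v. (u, v) \<in> parcs G}
            \<union> {(Inr u, Inr v) | u v. (u, v) \<in> parcs H}
            \<union> {(Inl u, Inr v) | u v. u \<in> pverts G \<and> v \<in> pverts H}
            \<union> {(Inr v, Inl u) | u v. u \<in> pverts G \<and> v \<in> pverts H} \<rparr>"

lemma pair_graph_iff:
  "pair_graph G \<longleftrightarrow>
    finite (pverts G) \<and> parcs G \<subseteq> pverts G \<times> pverts G \<and> sym (parcs G) \<and> irrefl (parcs G)"
proof
  assume "pair_graph G"
  then interpret pair_graph G .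
  show "finite (pverts G) \<and> parcs G \<subseteq> pverts G \<times> pverts G \<and> sym (parcs G) \<and> irrefl (parcs G)"
    using in_arcsD1 in_arcsD2 no_loops' pair_finite_verts arcs_symmetric
    by (fastforce simp: irrefl_def intro: symI)
next
  assume *: "finite (pverts G) \<and> parcs G \<subseteq> pverts G \<times> pverts G \<and> sym (parcs G) \<and> irrefl (parcs G)"
  then have "finite (parcs G)"
    by (meson finite_SigmaI finite_subset)
  with * show "pair_graph G"
    by unfold_locales (auto simp: symmetric_def irrefl_def)
qed

lemma complete_graph_complete: "complete_digraph n (with_proj (complete_graph n))"
  by (auto simp: complete_digraph_pair_def complete_graph_def)

lemma complete_bipartite_graph_complete_bipartite:
  "complete_bipartite_digraph m n (with_proj (complete_bipartite_graph m n))"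
  unfolding complete_bipartite_digraph_pair_def complete_bipartite_graph_def
  by (rule conjI, simp, rule exI[of _ "{..<m}"], rule exI[of _ "{m..<m + n}"]) auto

lemma pair_graph_complete_graph: "pair_graph (complete_graph n)"
  by (auto simp: pair_graph_iff complete_graph_def sym_def irrefl_def)

lemma pair_graph_complete_bipartite_graph: "pair_graph (complete_bipartite_graph m n)"
  by (auto simp: pair_graph_iff complete_bipartite_graph_def sym_def irrefl_def)

lemma pair_graph_cycle_graph: "n \<ge> 3 \<Longrightarrow> pair_graph (cycle_graph n)"
  by (auto simp: pair_graph_iff cycle_graph_def sym_def irrefl_def mod_Suc split: if_splits)

lemma pair_graph_disjoint_union:
  assumes "\<And>G. G \<in> set Gs \<Longrightarrow> pair_graph G"
  shows "pair_graph (disjoint_union Gs)"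
proof -
  have *: "pair_graph (Gs ! i)" if "i < length Gs" for i
    using that assms by simp
  have "pverts (disjoint_union Gs) = (SIGMA i:{..<length Gs}. pverts (Gs ! i))"
    by (auto simp: disjoint_union_def)
  then have "finite (pverts (disjoint_union Gs))"
    using * by (auto simp: pair_graph_iff)
  moreover have "parcs (disjoint_union Gs) \<subseteq> pverts (disjoint_union Gs) \<times> pverts (disjoint_union Gs)"
    using * by (fastforce simp: pair_graph_iff disjoint_union_def)
  moreover have "sym (parcs (disjoint_union Gs))"
    using * by (auto simp: pair_graph_iff disjoint_union_def intro!: symI dest: symD)
  moreover have "irrefl (parcs (disjoint_union Gs))"
    using * by (auto simp: pair_graph_iff disjoint_union_def irrefl_def)
  ultimately show ?thesis
    by (simp add: pair_graph_iff)
qed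

lemma pair_graph_graph_join:
  "pair_graph G \<Longrightarrow> pair_graph H \<Longrightarrow> pair_graph (graph_join G H)"
  by (auto simp: pair_graph_iff graph_join_def irrefl_def intro!: symI dest: symD)

section \<open>The signless Laplacian\<close>

text \<open>
  The matrices are indexed by the positions in a list enumerating the vertices. They are taken
  over the complex numbers, so that the multiset of roots of the characteristic polynomial
  contains all eigenvalues, with multiplicity, without an appeal to the symmetry of the matrix.
\<close>

definition adjacency_matrix :: "'a pair_pre_digraph \<Rightarrow> 'a list \<Rightarrow> complex mat" where
  "adjacency_matrix G vs = mat (length vs) (length vs)
    (\<lambda>(i, j). if (vs ! i, vs ! j) \<in> parcs G then 1 else 0)"

definition degree_matrix :: "'a pair_pre_digraph \<Rightarrow> 'a list \<Rightarrow> complex mat" where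
  "degree_matrix G vs = mat (length vs) (length vs)
    (\<lambda>(i, j). if i = j then of_nat (out_degree (with_proj G) (vs ! i)) else 0)"

definition signless_laplacian :: "'a pair_pre_digraph \<Rightarrow> 'a list \<Rightarrow> complex mat" where
  "signless_laplacian G vs = degree_matrix G vs + adjacency_matrix G vs"

text \<open>By \<open>Q_spectrum_eq\<close> below, the choice of the enumeration is immaterial.\<close>

definition vertex_enumeration :: "'a pair_pre_digraph \<Rightarrow> 'a list" where
  "vertex_enumeration G = (SOME vs. distinct vs \<and> set vs = pverts G)"

definition Q_spectrum :: "'a pair_pre_digraph \<Rightarrow> complex multiset" where
  "Q_spectrum G = proots (char_poly (signless_laplacian G (vertex_enumeration G)))"

definition Q_cospectral :: "'a pair_pre_digraph \<Rightarrow> 'b pair_pre_digraph \<Rightarrow> bool" where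
  "Q_cospectral G H \<longleftrightarrow> Q_spectrum G = Q_spectrum H"

text \<open>
  HOL does not allow quantification over all types of vertices inside a formula. Letting the
  competitor range over the graphs on natural numbers loses nothing: every finite graph is
  isomorphic to one of these.
\<close>

definition DQS :: "'a pair_pre_digraph \<Rightarrow> bool" where
  "DQS G \<longleftrightarrow> (\<forall>H :: nat pair_pre_digraph.
    pair_graph H \<longrightarrow> Q_cospectral H G \<longrightarrow> digraph_iso (with_proj H) (with_proj G))"

lemma det_permute_rows_cols:
  fixes A :: "'a :: comm_ring_1 mat"
  assumes A: "A \<in> carrier_mat n n" and p: "p permutes {0..<n}"
  shows "det (mat n n (\<lambda>(i, j). A $$ (p i, p j))) = det A"
proof -
  define B where "B = mat n n (\<lambda>(i, j). A $$ (i, p j))"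
  have B: "B \<in> carrier_mat n n"
    by (simp add: B_def)
  have lt: "p i < n" if "i < n" for i
    using permutes_in_image[OF p, of i] that by simp
  have T: "transpose_mat B = mat n n (\<lambda>(i, j). transpose_mat A $$ (p i, j))"
    using A lt by (intro eq_matI) (auto simp: B_def)
  have "mat n n (\<lambda>(i, j). A $$ (p i, p j)) = mat n n (\<lambda>(i, j). B $$ (p i, j))"
    using lt by (intro eq_matI) (auto simp: B_def)
  then have "det (mat n n (\<lambda>(i, j). A $$ (p i, p j))) = signof p * det B"
    by (simp add: det_permute_rows[OF B p])
  also have "det B = det (transpose_mat B)"
    by (simp add: det_transpose[OF B])
  also have "\<dots> = signof p * det A"
    using det_permute_rows[OF _ p, of "transpose_mat A"] A det_transpose[OF A] by (simp add: T)
  also have "signof p * (signof p * det A) = det A"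
    by (simp add: sign_def)
  finally show ?thesis .
qed

lemma Q_spectrum_eq:
  assumes vs: "distinct vs" "set vs = pverts G"
  shows "Q_spectrum G = proots (char_poly (signless_laplacian G vs))"
proof -
  define ws where "ws = vertex_enumeration G"
  have ws: "distinct ws \<and> set ws = pverts G"
    unfolding ws_def vertex_enumeration_def by (rule someI[of _ vs]) (use vs in simp)
  define n where "n = length vs"
  have "mset ws = mset vs"
    using ws vs by (simp add: set_eq_iff_mset_eq_distinct[symmetric])
  then obtain p where p: "p permutes {..<length vs}" "permute_list p vs = ws"
    by (rule mset_eq_permutation)
  have p': "p permutes {0..<n}"
    using p by (simp add: n_def atLeast0LessThan)
  have lt: "p i < n" if "i < n" for i
    using permutes_in_image[OF p', of i] that by simp
  have len: "length ws = n"
    using p(2) by (auto simp: n_def)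
  have nth: "ws ! i = vs ! p i" if "i < n" for i
    using permute_list_nth[OF p(1)] that p(2) by (simp add: n_def)
  have inj: "p i = p j \<longleftrightarrow> i = j" for i j
    using permutes_inj[OF p'] by (auto dest: injD)
  let ?M = "char_poly_matrix (signless_laplacian G vs)"
  have "?M \<in> carrier_mat n n"
    by (intro char_poly_matrix_closed)
      (simp add: signless_laplacian_def adjacency_matrix_def degree_matrix_def n_def)
  moreover have "char_poly_matrix (signless_laplacian G ws) = mat n n (\<lambda>(i, j). ?M $$ (p i, p j))"
    using lt len by (intro eq_matI)
      (auto simp: char_poly_matrix_def signless_laplacian_def adjacency_matrix_def
        degree_matrix_def n_def[symmetric] nth inj)
  ultimately have "char_poly (signless_laplacian G ws) = char_poly (signless_laplacian G vs)"
    using det_permute_rows_cols[OF _ p'] by (simp add: char_poly_def)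
  then show ?thesis
    by (simp add: Q_spectrum_def ws_def)
qed

end

theory Submission
  imports Defs
begin

text \<open>
  Write \<open>G = K\<^sub>1 \<or> (C\<^sub>3 \<union> K\<^sub>1 \<union> R)\<close> and \<open>H = K\<^sub>1 \<or> (K\<^sub>1\<^sub>,\<^sub>3 \<union> R)\<close>, where \<open>R\<close> is the common
  remainder. The two graphs differ only on four vertices: an isolated point together with a
  triangle in \<open>G\<close>, a centre together with three leaves in \<open>H\<close>. The signless Laplacians of the
  four-vertex graphs \<open>C\<^sub>3 \<union> K\<^sub>1\<close> and \<open>K\<^sub>1\<^sub>,\<^sub>3\<close> both have eigenvalues \<open>4, 1, 1, 0\<close>, and the
  all-ones vector has projections of the same length on corresponding eigenspaces. Hence one is
  conjugate to the other by an orthogonal matrix fixing the all-ones vector. Such a matrix is the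
  reflection in the hyperplane orthogonal to \<open>(3, -1, -1, -1)\<close>
  (\<open>claw_reflection_conjugates\<close>).

  The remaining vertices see the four exchanged ones only through multiples of the all-ones
  vector: the apex is adjacent to all four, every other vertex to none. So the reflection,
  extended by the identity, conjugates the whole signless Laplacian of \<open>G\<close> into that of \<open>H\<close>
  (\<open>Q_cospectral_replace\<close>, \<open>Q_cospectral_triangle_point_claw\<close>). This holds for
  every \<open>R\<close>.

  The graphs are not isomorphic when \<open>R\<close> consists of cycles, at least one edge, and points: the
  centre of the claw has degree 4 in \<open>H\<close>, whereas in \<open>G\<close> the vertices other than the apex have
  degree at most 3 and the apex has degree at least 5, due to a triangle and an edge.
\<close>

section \<open>Isomorphic copies and degrees\<close>

lemma out_degree_with_proj: "out_degree (with_proj G) u = card (parcs G `` {u})"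
proof -
  have "out_arcs (with_proj G) u = Pair u ` (parcs G `` {u})"
    by (auto simp: out_arcs_def)
  then show ?thesis
    by (simp add: out_degree_def card_image inj_on_def)
qed

definition relabel :: "('a \<Rightarrow> 'b) \<Rightarrow> 'a pair_pre_digraph \<Rightarrow> 'b pair_pre_digraph" where
  "relabel f G = \<lparr> pverts = f ` pverts G, parcs = map_prod f f ` parcs G \<rparr>"

lemma map_prod_mem_iff:
  assumes "inj_on f A" "R \<subseteq> A \<times> A" "u \<in> A" "v \<in> A"
  shows "(f u, f v) \<in> map_prod f f ` R \<longleftrightarrow> (u, v) \<in> R"
proof
  assume "(f u, f v) \<in> map_prod f f ` R"
  then obtain u' v' where *: "(u', v') \<in> R" "f u = f u'" "f v = f v'"
    by auto
  moreover have "u' \<in> A" "v' \<in> A"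
    using * assms(2) by auto
  ultimately have "u = u'" "v = v'"
    using assms(1,3,4) by (simp_all add: inj_on_eq_iff)
  then show "(u, v) \<in> R"
    using * by simp
qed (metis image_eqI map_prod_simp)

lemma pair_graph_relabel:
  assumes "pair_graph G" "inj_on f (pverts G)"
  shows "pair_graph (relabel f G)"
proof -
  have G: "finite (pverts G)" "parcs G \<subseteq> pverts G \<times> pverts G" "sym (parcs G)" "irrefl (parcs G)"
    using assms by (simp_all add: pair_graph_iff)
  have "irrefl (map_prod f f ` parcs G)"
  proof (rule irreflI)
    fix x
    show "(x, x) \<notin> map_prod f f ` parcs G"
    proof
      assume "(x, x) \<in> map_prod f f ` parcs G"
      then obtain u v where *: "(u, v) \<in> parcs G" "f u = f v"
        by auto
      then have "u = v"
        using G(2) assms(2) by (auto dest: inj_onD)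
      then show False
        using * G(4) by (auto dest: irreflD)
    qed
  qed
  moreover have "sym (map_prod f f ` parcs G)"
    using G(3) by (force simp: sym_def)
  ultimately show ?thesis
    using G(1,2) by (auto simp: pair_graph_iff relabel_def)
qed

lemma digraph_iso_relabel:
  assumes "pair_graph G" "inj_on f (pverts G)"
  shows "digraph_iso (with_proj G) (with_proj (relabel f G))"
proof -
  interpret pair_graph G by fact
  let ?h = "\<lparr> iso_verts = f, iso_arcs = map_prod f f, iso_head = snd, iso_tail = fst \<rparr>"
  have "inj_on (map_prod f f) (parcs G)"
    using map_prod_inj_on[OF assms(2,2)] assms(1) by (auto simp: pair_graph_iff intro: inj_on_subset)
  then have "pre_digraph.digraph_isomorphism (with_proj G) ?h"
    using assms(2) by (auto simp: digraph_isomorphism_def wf_digraph)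
  moreover have "with_proj (relabel f G) = app_iso ?h (with_proj G)"
    by (simp add: with_proj_def app_iso_def relabel_def)
  ultimately show ?thesis
    by (auto simp: digraph_iso_def)
qed

lemma digraph_iso_out_degree:
  assumes "digraph_iso G H" "u \<in> verts G"
  obtains v where "v \<in> verts H" "out_degree H v = out_degree G u"
proof -
  obtain h where h: "pre_digraph.digraph_isomorphism G h" and H: "H = app_iso h G"
    using assms(1) by (auto simp: digraph_iso_def)
  then interpret wf_digraph G
    by (simp add: pre_digraph.digraph_isomorphism_def)
  show thesis
    using that[of "iso_verts h u"] out_degree_app_iso_eq[OF h assms(2)] assms(2) H by simp
qed

lemma Q_cospectral_relabel:
  assumes "pair_graph G" "inj_on f (pverts G)"
  shows "Q_cospectral (relabel f G) G"
proof -
  have fin: "finite (pverts G)" and sub: "parcs G \<subseteq> pverts G \<times> pverts G"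
    using assms(1) by (simp_all add: pair_graph_iff)
  obtain vs where vs: "set vs = pverts G" "distinct vs"
    using finite_distinct_list[OF fin] by blast
  have mem: "vs ! i \<in> pverts G" if "i < length vs" for i
    using that vs(1) nth_mem by blast
  have iff: "(f u, f v) \<in> parcs (relabel f G) \<longleftrightarrow> (u, v) \<in> parcs G"
    if "u \<in> pverts G" "v \<in> pverts G" for u v
    using map_prod_mem_iff[OF assms(2) sub that] by (simp add: relabel_def)
  have deg: "out_degree (with_proj (relabel f G)) (f u) = out_degree (with_proj G) u"
    if u: "u \<in> pverts G" for u
  proof -
    have "parcs (relabel f G) `` {f u} = f ` (parcs G `` {u})"
    proof (intro equalityI subsetI)
      fix x
      assume x: "x \<in> parcs (relabel f G) `` {f u}"
      then obtain v where "x = f v" "v \<in> pverts G"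
        using sub by (auto simp: relabel_def)
      then show "x \<in> f ` (parcs G `` {u})"
        using x iff[OF u] by auto
    next
      fix x
      assume "x \<in> f ` (parcs G `` {u})"
      then show "x \<in> parcs (relabel f G) `` {f u}"
        using sub iff[OF u] by auto
    qed
    moreover have "inj_on f (parcs G `` {u})"
      using sub by (intro inj_on_subset[OF assms(2)]) auto
    ultimately show ?thesis
      by (simp add: out_degree_with_proj card_image)
  qed
  have "signless_laplacian (relabel f G) (map f vs) = signless_laplacian G vs"
    by (rule eq_matI)
      (auto simp: signless_laplacian_def degree_matrix_def adjacency_matrix_def iff deg mem)
  moreover have "Q_spectrum (relabel f G) =
      proots (char_poly (signless_laplacian (relabel f G) (map f vs)))"
    using vs assms(2) by (intro Q_spectrum_eq) (auto simp: distinct_map relabel_def)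
  ultimately show ?thesis
    using Q_spectrum_eq[OF vs(2,1)] by (simp add: Q_cospectral_def)
qed

text \<open>
  The competitors admitted by \<open>DQS\<close> live on natural numbers; a copy of \<open>H\<close> there serves when
  \<open>H\<close> itself lives elsewhere.
\<close>

lemma not_DQS_if_Q_cospectral_not_iso:
  fixes H :: "'a pair_pre_digraph"
  assumes H: "pair_graph H" and cosp: "Q_cospectral H G"
    and "\<not> digraph_iso (with_proj H) (with_proj G)"
  shows "\<not> DQS G"
proof
  assume "DQS G"
  have "finite (pverts H)"
    using H by (simp add: pair_graph_iff)
  then obtain f :: "'a \<Rightarrow> nat" where f: "inj_on f (pverts H)"
    using finite_imp_inj_to_nat_seg by metis
  have "Q_cospectral (relabel f H) G"
    using Q_cospectral_relabel[OF H f] cosp by (simp add: Q_cospectral_def)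
  then have "digraph_iso (with_proj (relabel f H)) (with_proj G)"
    using \<open>DQS G\<close> pair_graph_relabel[OF H f] by (simp add: DQS_def)
  with digraph_iso_relabel[OF H f] assms(3) show False
    by (blast intro: digraph_iso_trans)
qed

section \<open>Replacing part of a graph\<close>

text \<open>
  The similarity is by the block diagonal matrix with blocks \<open>P\<close> and \<open>1\<close>, which leaves
  the blocks other than \<open>A\<close> as they are.
\<close>

lemma char_poly_four_block_conjugate:
  fixes A :: "'a :: field mat"
  assumes A: "A \<in> carrier_mat m m" and A': "A' \<in> carrier_mat m m"
    and B: "B \<in> carrier_mat m n" and C: "C \<in> carrier_mat n m" and D: "D \<in> carrier_mat n n"
    and P: "P \<in> carrier_mat m m" and PP: "P * P = 1\<^sub>m m" and PA: "P * A = A' * P"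
    and PB: "P * B = B" and CP: "C * P = C"
  shows "char_poly (four_block_mat A B C D) = char_poly (four_block_mat A' B C D)"
proof -
  let ?P = "four_block_mat P (0\<^sub>m m n) (0\<^sub>m n m) (1\<^sub>m n)"
  have "P * A * P = A' * (P * P)"
    using A A' P by (simp add: PA)
  then have PAP: "P * A * P = A'"
    using A' by (simp add: PP)
  have PPone: "?P * ?P = 1\<^sub>m (m + n)"
    using P by (subst mult_four_block_mat) (auto simp: PP)
  have "?P * four_block_mat A B C D * ?P = four_block_mat (P * A) B C D * ?P"
    using A B C D P by (subst mult_four_block_mat) (auto simp: PB)
  also have "\<dots> = four_block_mat A' B C D"
    using A B C D P A' by (subst mult_four_block_mat[of _ m m _ n _ n]) (auto simp: CP PAP)
  finally have "four_block_mat A' B C D = ?P * four_block_mat A B C D * ?P" ..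
  then have "similar_mat (four_block_mat A' B C D) (four_block_mat A B C D)"
    using A A' B C D P PPone by (intro similar_matI[of _ _ ?P ?P "m + n"]) auto
  then show ?thesis
    by (metis char_poly_similar)
qed

text \<open>
  The diagonal blocks carry the degrees in the whole graph, so they are again of the form
  \<open>signless_laplacian G ws\<close> even though \<open>ws\<close> does not exhaust the vertices.
\<close>

lemma signless_laplacian_append:
  assumes "distinct (as @ rs)"
  shows "signless_laplacian G (as @ rs) = four_block_mat (signless_laplacian G as)
      (mat (length as) (length rs) (\<lambda>(i, j). if (as ! i, rs ! j) \<in> parcs G then 1 else 0))
      (mat (length rs) (length as) (\<lambda>(i, j). if (rs ! i, as ! j) \<in> parcs G then 1 else 0))
      (signless_laplacian G rs)"
  by (rule eq_matI)
    (auto simp: signless_laplacian_def degree_matrix_def adjacency_matrix_def nth_append)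

lemma out_degree_append:
  assumes "pair_graph G" "distinct (as @ rs)" "set (as @ rs) = pverts G"
  shows "out_degree (with_proj G) u =
    card {a \<in> set as. (u, a) \<in> parcs G} + card {r \<in> set rs. (u, r) \<in> parcs G}"
proof -
  have "parcs G `` {u} = {a \<in> set as. (u, a) \<in> parcs G} \<union> {r \<in> set rs. (u, r) \<in> parcs G}"
    using assms(1,3) by (auto simp: pair_graph_iff)
  then show ?thesis
    using assms(2) by (simp add: out_degree_with_proj card_Un_disjoint disjoint_iff)
qed

text \<open>
  A vertex of the common part \<open>rs\<close> is joined to all of \<open>as\<close> and all of \<open>bs\<close>, or to none of them
  (this is what the hypothesis on \<open>u\<close>, \<open>a\<close>, \<open>b\<close> amounts to). Hence it keeps its degree, and
  the off-diagonal blocks of the two signless Laplacians have constant columns and rows; a matrix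
  with row and column sums 1 preserves them.
\<close>

lemma Q_cospectral_replace:
  assumes G: "pair_graph G" "distinct (as @ rs)" "set (as @ rs) = pverts G"
    and H: "pair_graph H" "distinct (bs @ rs)" "set (bs @ rs) = pverts H"
    and len: "length as = m" "length bs = m"
    and rs: "\<And>u v. u \<in> set rs \<Longrightarrow> v \<in> set rs \<Longrightarrow> (u, v) \<in> parcs G \<longleftrightarrow> (u, v) \<in> parcs H"
    and out: "\<And>u a b. u \<in> set rs \<Longrightarrow> a \<in> set as \<Longrightarrow> b \<in> set bs \<Longrightarrow>
      (u, a) \<in> parcs G \<longleftrightarrow> (u, b) \<in> parcs H"
    and P: "P \<in> carrier_mat m m" and PP: "P * P = 1\<^sub>m m"
    and rows: "\<And>i. i < m \<Longrightarrow> (\<Sum>j<m. P $$ (i, j)) = 1"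
    and cols: "\<And>j. j < m \<Longrightarrow> (\<Sum>i<m. P $$ (i, j)) = 1"
    and conj: "P * signless_laplacian G as = signless_laplacian H bs * P"
  shows "Q_cospectral G H"
proof -
  have symG: "(u, v) \<in> parcs G \<longleftrightarrow> (v, u) \<in> parcs G" for u v
    using G(1) by (auto simp: pair_graph_iff dest: symD)
  have symH: "(u, v) \<in> parcs H \<longleftrightarrow> (v, u) \<in> parcs H" for u v
    using H(1) by (auto simp: pair_graph_iff dest: symD)
  \<comment> \<open>Whether a common vertex sees the exchanged part; for \<open>m = 0\<close> the value is arbitrary.\<close>
  define c :: "'a \<Rightarrow> bool" where "c u \<longleftrightarrow> (u, as ! 0) \<in> parcs G" for u
  have c: "(u, b) \<in> parcs H \<longleftrightarrow> c u" if "u \<in> set rs" "b \<in> set bs" for u b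
  proof -
    have "as ! 0 \<in> set as"
      using that(2) len by (cases bs) auto
    then show ?thesis
      using out that by (auto simp: c_def)
  qed
  have c': "(u, a) \<in> parcs G \<longleftrightarrow> c u" if "u \<in> set rs" "a \<in> set as" for u a
  proof -
    have "bs ! 0 \<in> set bs"
      using that(2) len by (cases as) auto
    then show ?thesis
      using out[OF that] c[OF that(1)] by auto
  qed
  have deg: "out_degree (with_proj G) u = out_degree (with_proj H) u" if u: "u \<in> set rs" for u
  proof -
    have "card (set as) = card (set bs)"
      using G(2) H(2) len by (simp add: distinct_card)
    moreover have "{a \<in> set as. (u, a) \<in> parcs G} = (if c u then set as else {})"
      using c'[OF u] by auto
    moreover have "{b \<in> set bs. (u, b) \<in> parcs H} = (if c u then set bs else {})"
      using c[OF u] by auto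
    moreover have "{r \<in> set rs. (u, r) \<in> parcs G} = {r \<in> set rs. (u, r) \<in> parcs H}"
      using rs[OF u] by auto
    ultimately show ?thesis
      by (simp add: out_degree_append[OF G] out_degree_append[OF H])
  qed
  define n where "n = length rs"
  define B :: "complex mat" where "B = mat m n (\<lambda>(i, j). if c (rs ! j) then 1 else 0)"
  define C :: "complex mat" where "C = mat n m (\<lambda>(i, j). if c (rs ! i) then 1 else 0)"
  have D: "signless_laplacian G rs = signless_laplacian H rs"
    by (rule eq_matI)
      (auto simp: signless_laplacian_def degree_matrix_def adjacency_matrix_def deg rs)
  have carrier: "signless_laplacian K ws \<in> carrier_mat (length ws) (length ws)"
    for K :: "'a pair_pre_digraph" and ws
    by (auto simp: signless_laplacian_def degree_matrix_def adjacency_matrix_def)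
  have LG: "signless_laplacian G (as @ rs) =
      four_block_mat (signless_laplacian G as) B C (signless_laplacian G rs)"
    unfolding signless_laplacian_append[OF G(2)]
    by (intro arg_cong4[where f = four_block_mat] eq_matI)
      (auto simp: B_def C_def n_def len symG[of "as ! _"] c')
  have LH: "signless_laplacian H (bs @ rs) =
      four_block_mat (signless_laplacian H bs) B C (signless_laplacian G rs)"
    unfolding signless_laplacian_append[OF H(2)] D
    by (intro arg_cong4[where f = four_block_mat] eq_matI)
      (auto simp: B_def C_def n_def len symH[of "bs ! _"] c)
  have PB: "P * B = B"
    using P rows
    by (intro eq_matI) (auto simp: B_def scalar_prod_def atLeast0LessThan)
  have CP: "C * P = C"
    using P cols
    by (intro eq_matI) (auto simp: C_def scalar_prod_def atLeast0LessThan)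
  have "char_poly (signless_laplacian G (as @ rs)) = char_poly (signless_laplacian H (bs @ rs))"
    unfolding LG LH
    using carrier[of G as] carrier[of H bs] carrier[of G rs] len
    by (intro char_poly_four_block_conjugate[OF _ _ _ _ _ P PP conj PB CP, where n = n])
      (auto simp: B_def C_def n_def)
  then show ?thesis
    using Q_spectrum_eq[OF G(2,3)] Q_spectrum_eq[OF H(2,3)] by (simp add: Q_cospectral_def)
qed

section \<open>Cones over disjoint unions\<close>

definition cone :: "'a pair_pre_digraph \<Rightarrow> (nat + 'a) pair_pre_digraph" where
  "cone G = graph_join (complete_graph 1) G"

lemma pair_graph_cone: "pair_graph G \<Longrightarrow> pair_graph (cone G)"
  by (simp add: cone_def pair_graph_graph_join pair_graph_complete_graph)

lemma pverts_cone: "pverts (cone G) = insert (Inl 0) (Inr ` pverts G)"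
  by (auto simp: cone_def graph_join_def complete_graph_def)

lemma parcs_cone:
  "(Inl a, Inl b) \<notin> parcs (cone G)"
  "(Inl a, Inr v) \<in> parcs (cone G) \<longleftrightarrow> a = 0 \<and> v \<in> pverts G"
  "(Inr v, Inl a) \<in> parcs (cone G) \<longleftrightarrow> a = 0 \<and> v \<in> pverts G"
  "(Inr u, Inr v) \<in> parcs (cone G) \<longleftrightarrow> (u, v) \<in> parcs G"
  by (auto simp: cone_def graph_join_def complete_graph_def)

lemma out_degree_cone_apex: "out_degree (with_proj (cone G)) (Inl 0) = card (pverts G)"
proof -
  have "parcs (cone G) `` {Inl 0} = Inr ` pverts G"
    by (auto simp: cone_def graph_join_def complete_graph_def)
  then show ?thesis
    by (simp add: out_degree_with_proj card_image)
qed

lemma out_degree_cone_base: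
  assumes "pair_graph G" "v \<in> pverts G"
  shows "out_degree (with_proj (cone G)) (Inr v) = Suc (out_degree (with_proj G) v)"
proof -
  have "parcs (cone G) `` {Inr v} = insert (Inl 0) (Inr ` (parcs G `` {v}))"
    using assms(2) by (auto simp: cone_def graph_join_def complete_graph_def)
  moreover have "finite (parcs G `` {v})"
    using assms(1) by (auto simp: pair_graph_iff intro: finite_subset[of _ "pverts G"])
  ultimately show ?thesis
    by (simp add: out_degree_with_proj card_image card_insert_if image_iff)
qed

lemma out_degree_disjoint_union:
  assumes "i < length Gs"
  shows "out_degree (with_proj (disjoint_union Gs)) (i, v) = out_degree (with_proj (Gs ! i)) v"
proof -
  have "parcs (disjoint_union Gs) `` {(i, v)} = Pair i ` (parcs (Gs ! i) `` {v})"
    using assms by (auto simp: disjoint_union_def)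
  then show ?thesis
    by (simp add: out_degree_with_proj card_image inj_on_def)
qed

lemma out_degree_cone_disjoint_union:
  assumes "\<And>G. G \<in> set Gs \<Longrightarrow> pair_graph G" "i < length Gs" "v \<in> pverts (Gs ! i)"
  shows "out_degree (with_proj (cone (disjoint_union Gs))) (Inr (i, v)) =
    Suc (out_degree (with_proj (Gs ! i)) v)"
  using assms out_degree_cone_base[OF pair_graph_disjoint_union[of Gs], of "(i, v)"]
  by (simp add: out_degree_disjoint_union) (simp add: disjoint_union_def)

lemma out_degree_complete_graph:
  assumes "v < n"
  shows "out_degree (with_proj (complete_graph n)) v = n - 1"
proof -
  have "parcs (complete_graph n) `` {v} = {..<n} - {v}"
    using assms by (auto simp: complete_graph_def)
  then show ?thesis
    using assms by (simp add: out_degree_with_proj)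
qed

lemma out_degree_cycle_graph_le: "out_degree (with_proj (cycle_graph n)) v \<le> 2"
proof -
  have "parcs (cycle_graph n) `` {v} \<subseteq> {Suc v mod n, if v = 0 then n - 1 else v - 1}"
    by (auto simp: cycle_graph_def mod_Suc split: if_splits)
  then have "card (parcs (cycle_graph n) `` {v}) \<le>
      card {Suc v mod n, if v = 0 then n - 1 else v - 1}"
    by (intro card_mono) auto
  also have "\<dots> \<le> 2"
    by (simp add: card_insert_if)
  finally show ?thesis
    by (simp add: out_degree_with_proj)
qed

lemma out_degree_triangle:
  assumes "v < 3"
  shows "out_degree (with_proj (cycle_graph 3)) v = 2"
proof -
  have "parcs (cycle_graph 3) `` {v} = {..<3} - {v}"
    using assms by (auto simp: cycle_graph_def mod_Suc split: if_splits)
  then show ?thesis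
    using assms by (simp add: out_degree_with_proj)
qed

lemma out_degree_star_centre:
  "out_degree (with_proj (complete_bipartite_graph 1 n)) 0 = n"
proof -
  have "parcs (complete_bipartite_graph 1 n) `` {0} = {1..<1 + n}"
    by (auto simp: complete_bipartite_graph_def)
  then show ?thesis
    by (simp add: out_degree_with_proj)
qed

lemma out_degree_star_leaf:
  assumes "0 < v" "v \<le> n"
  shows "out_degree (with_proj (complete_bipartite_graph 1 n)) v = 1"
proof -
  have "parcs (complete_bipartite_graph 1 n) `` {v} = {0}"
    using assms by (auto simp: complete_bipartite_graph_def)
  then show ?thesis
    by (simp add: out_degree_with_proj)
qed

section \<open>Exchanging a triangle and a point for a claw\<close>

lemma less_4_cases: "(i::nat) < 4 \<longleftrightarrow> i = 0 \<or> i = 1 \<or> i = 2 \<or> i = 3"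
  by auto

text \<open>
  The reflection \<open>I - 2 x x\<^sup>T / |x|\<^sup>2\<close> for \<open>x = (3, -1, -1, -1)\<close>, where \<open>|x|\<^sup>2 = 12\<close>. Index 0 stands
  for the point, respectively the centre of the claw; the indices 1, 2, 3 stand for the triangle,
  respectively the leaves.
\<close>

definition claw_reflection :: "complex mat" where
  "claw_reflection = (let x = (\<lambda>i::nat. if i = 0 then 3 else - 1) in
    mat 4 4 (\<lambda>(i, j). (if i = j then 1 else 0) - x i * x j / 6))"

lemma sum_less_4: "(\<Sum>i<4. f i) = f 0 + f 1 + f 2 + f (3::nat)"
  by (simp add: eval_nat_numeral)

lemma sum_0_less_4: "(\<Sum>i = 0..<4. f i) = f 0 + f 1 + f 2 + f (3::nat)"
  by (simp add: eval_nat_numeral)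

lemma claw_reflection_involution: "claw_reflection * claw_reflection = 1\<^sub>m 4"
  by (rule eq_matI)
    (auto simp: claw_reflection_def scalar_prod_def less_4_cases sum_0_less_4 Let_def)

lemma claw_reflection_row_sum: "i < 4 \<Longrightarrow> (\<Sum>j<4. claw_reflection $$ (i, j)) = 1"
  by (auto simp: claw_reflection_def sum_less_4 less_4_cases Let_def)

lemma claw_reflection_col_sum: "j < 4 \<Longrightarrow> (\<Sum>i<4. claw_reflection $$ (i, j)) = 1"
  by (auto simp: claw_reflection_def sum_less_4 less_4_cases Let_def)

text \<open>
  The matrices are \<open>I + Q(K\<^sub>1 \<union> C\<^sub>3)\<close> and \<open>I + Q(K\<^sub>1\<^sub>,\<^sub>3)\<close>; the summand \<open>I\<close> is the
  contribution of the apex to the degrees. Both matrices act alike on the vectors with entry 0 at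
  index 0 and sum 0, which the reflection fixes. On the span of the eigenvectors to the eigenvalues
  5 and 1 that are left, it interchanges \<open>2 (0, 1, 1, 1)\<close> with \<open>(3, 1, 1, 1)\<close> and
  \<open>2 (1, 0, 0, 0)\<close> with \<open>(-1, 1, 1, 1)\<close>.
\<close>

lemma claw_reflection_conjugates:
  "claw_reflection * mat 4 4 (\<lambda>(i, j). if i = j then if i = 0 then 1 else 3
       else if i = 0 \<or> j = 0 then 0 else 1) =
   mat 4 4 (\<lambda>(i, j). if i = j then if i = 0 then 4 else 2
       else if i = 0 \<or> j = 0 then 1 else 0) * claw_reflection"
  by (rule eq_matI)
    (auto simp: claw_reflection_def scalar_prod_def less_4_cases sum_0_less_4 Let_def)

lemma Q_cospectral_triangle_point_claw:
  assumes Rs: "\<And>R. R \<in> set Rs \<Longrightarrow> pair_graph R"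
  shows "Q_cospectral
    (cone (disjoint_union ([cycle_graph 3] @ Rs @ [complete_graph 1])))
    (cone (disjoint_union ([complete_bipartite_graph 1 3] @ Rs)))"
    (is "Q_cospectral (cone (disjoint_union ?Gs)) (cone (disjoint_union ?Hs))")
proof -
  define m where "m = Suc (length Rs)"
  have Gs: "pair_graph K" if "K \<in> set ?Gs" for K
    using that Rs pair_graph_cycle_graph[of 3] pair_graph_complete_graph[of 1] by auto
  have Hs: "pair_graph K" if "K \<in> set ?Hs" for K
    using that Rs pair_graph_complete_bipartite_graph[of 1 3] by auto
  have point: "?Gs ! m = complete_graph 1"
    by (simp add: m_def nth_append)
  have rest: "?Gs ! i = Rs ! (i - 1)" "?Hs ! i = Rs ! (i - 1)" if "0 < i" "i < m" for i
    using that by (auto simp: m_def nth_append nth_Cons')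
  have len: "length ?Gs = Suc m" "length ?Hs = m"
    by (simp_all add: m_def)
  have G: "pair_graph (cone (disjoint_union ?Gs))" and H: "pair_graph (cone (disjoint_union ?Hs))"
    using pair_graph_disjoint_union[of ?Gs] pair_graph_disjoint_union[of ?Hs] Gs Hs
    by (blast intro: pair_graph_cone)+
  \<comment> \<open>The component \<open>i\<close> of either union is \<open>Rs ! (i - 1)\<close> for \<open>0 < i < m\<close>, so the untouched
    vertices have literally the same names in both graphs. The point is component \<open>m\<close>.\<close>
  define S where "S = {(i, v). 0 < i \<and> i < m \<and> v \<in> pverts (Rs ! (i - 1))}"
  have arcs_rest: "((i, u), (j, v)) \<in> parcs (disjoint_union ?Gs) \<longleftrightarrow>
      ((i, u), (j, v)) \<in> parcs (disjoint_union ?Hs)"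
    if "(i, u) \<in> S" for i u j v
    using that rest[of i] len by (auto simp: S_def disjoint_union_def)
  have vG: "pverts (disjoint_union ?Gs) = {(m, 0), (0, 0), (0, 1), (0, 2)} \<union> S"
  proof -
    have "(i, v) \<in> pverts (disjoint_union ?Gs) \<longleftrightarrow>
        (i, v) \<in> {(m, 0), (0, 0), (0, 1), (0, 2)} \<union> S" for i v
    proof -
      consider "i = 0" | "i = m" | "0 < i" "i < m" | "i > m" by linarith
      then show ?thesis
      proof cases
        case 1
        then show ?thesis by (auto simp: disjoint_union_def S_def cycle_graph_def m_def)
      next
        case 2
        then show ?thesis using point len
          by (auto simp: disjoint_union_def S_def complete_graph_def m_def)
      next
        case 3
        then show ?thesis using rest[of i] len by (auto simp: disjoint_union_def S_def)
      next
        case 4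
        then show ?thesis using len by (auto simp: disjoint_union_def S_def)
      qed
    qed
    then show ?thesis by auto
  qed
  have vH: "pverts (disjoint_union ?Hs) = {(0, 0), (0, 1), (0, 2), (0, 3)} \<union> S"
  proof -
    have "(i, v) \<in> pverts (disjoint_union ?Hs) \<longleftrightarrow>
        (i, v) \<in> {(0, 0), (0, 1), (0, 2), (0, 3)} \<union> S" for i v
    proof -
      consider "i = 0" | "0 < i" "i < m" | "i \<ge> m" "i > 0" by linarith
      then show ?thesis
      proof cases
        case 1
        then show ?thesis by (auto simp: disjoint_union_def S_def complete_bipartite_graph_def m_def)
      next
        case 2
        then show ?thesis using rest[of i] len by (auto simp: disjoint_union_def S_def)
      next
        case 3
        then show ?thesis using len by (auto simp: disjoint_union_def S_def)
      qed
    qed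
    then show ?thesis by auto
  qed
  have "finite S"
    using pair_graph_disjoint_union[of ?Gs, OF Gs] unfolding pair_graph_iff vG by simp
  then obtain rs :: "(nat + nat \<times> nat) list" where rs: "set rs = insert (Inl 0) (Inr ` S)" "distinct rs"
    using finite_distinct_list[of "insert (Inl 0) (Inr ` S)"] by auto
  define as :: "(nat + nat \<times> nat) list"
    where "as = map Inr [(m, 0), (0, 0), (0, 1), (0, 2)]"
  define bs :: "(nat + nat \<times> nat) list"
    where "bs = map Inr [(0, 0), (0, 1), (0, 2), (0, 3)]"
  have LG: "signless_laplacian (cone (disjoint_union ?Gs)) as =
      mat 4 4 (\<lambda>(i, j). if i = j then if i = 0 then 1 else 3
       else if i = 0 \<or> j = 0 then 0 else 1)"
    (is "_ = ?M")
  proof -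
    have "out_degree (with_proj (cone (disjoint_union ?Gs))) (Inr (m, 0)) = 1"
      using out_degree_cone_disjoint_union[of ?Gs m 0] Gs len point
      by (simp add: out_degree_complete_graph) (simp add: complete_graph_def)
    moreover have "out_degree (with_proj (cone (disjoint_union ?Gs))) (Inr (0, v)) = 3"
      if "v < 3" for v
      using out_degree_cone_disjoint_union[of ?Gs 0 v] Gs that
      by (simp add: out_degree_triangle) (simp add: cycle_graph_def)
    moreover have "((0, u), (0, v)) \<in> parcs (disjoint_union ?Gs) \<longleftrightarrow> u \<noteq> v"
      if "u < 3" "v < 3" for u v
      using that by (auto simp: disjoint_union_def cycle_graph_def mod_Suc)
    moreover have "((m, 0), (0, v)) \<notin> parcs (disjoint_union ?Gs)"
      "((0, v), (m, 0)) \<notin> parcs (disjoint_union ?Gs)"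
      "((m, 0), (m, 0)) \<notin> parcs (disjoint_union ?Gs)" for v
      by (simp_all add: disjoint_union_def point m_def complete_graph_def nth_append)
    moreover have "length as = 4" "as ! 0 = Inr (m, 0)" "as ! 1 = Inr (0, 0)"
      "as ! 2 = Inr (0, 1)" "as ! 3 = Inr (0, 2)"
      by (simp_all add: as_def)
    ultimately have "signless_laplacian (cone (disjoint_union ?Gs)) as $$ (i, j) = ?M $$ (i, j)"
      if "i < 4" "j < 4" for i j
      using that unfolding less_4_cases
      by (elim disjE) (simp_all add: signless_laplacian_def degree_matrix_def
          adjacency_matrix_def parcs_cone del: append.simps One_nat_def)
    then show ?thesis
      by (intro eq_matI)
        (simp_all add: signless_laplacian_def degree_matrix_def adjacency_matrix_def as_def)
  qed
  have LH: "signless_laplacian (cone (disjoint_union ?Hs)) bs =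
      mat 4 4 (\<lambda>(i, j). if i = j then if i = 0 then 4 else 2
       else if i = 0 \<or> j = 0 then 1 else 0)"
    (is "_ = ?M")
  proof -
    have "out_degree (with_proj (cone (disjoint_union ?Hs))) (Inr (0, 0)) = 4"
      using out_degree_cone_disjoint_union[of ?Hs 0 0] Hs out_degree_star_centre[of 3]
      by simp (simp add: complete_bipartite_graph_def)
    moreover have "out_degree (with_proj (cone (disjoint_union ?Hs))) (Inr (0, v)) = 2"
      if "0 < v" "v \<le> 3" for v
      using out_degree_cone_disjoint_union[of ?Hs 0 v] Hs that out_degree_star_leaf[of v 3]
      by simp (simp add: complete_bipartite_graph_def)
    moreover have "((0, u), (0, v)) \<in> parcs (disjoint_union ?Hs) \<longleftrightarrow> (u = 0) \<noteq> (v = 0)"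
      if "u \<le> 3" "v \<le> 3" for u v
      using that by (auto simp: disjoint_union_def complete_bipartite_graph_def)
    moreover have "length bs = 4" "bs ! 0 = Inr (0, 0)" "bs ! 1 = Inr (0, 1)"
      "bs ! 2 = Inr (0, 2)" "bs ! 3 = Inr (0, 3)"
      by (simp_all add: bs_def)
    ultimately have "signless_laplacian (cone (disjoint_union ?Hs)) bs $$ (i, j) = ?M $$ (i, j)"
      if "i < 4" "j < 4" for i j
      using that unfolding less_4_cases
      by (elim disjE) (simp_all add: signless_laplacian_def degree_matrix_def
          adjacency_matrix_def parcs_cone del: append.simps One_nat_def)
    then show ?thesis
      by (intro eq_matI)
        (simp_all add: signless_laplacian_def degree_matrix_def adjacency_matrix_def bs_def)
  qed
  show ?thesis
  proof (rule Q_cospectral_replace[where as = as and bs = bs and rs = rs and m = 4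
        and P = claw_reflection])
    show "distinct (as @ rs)" "distinct (bs @ rs)"
      using rs by (auto simp: as_def bs_def S_def m_def)
    show "set (as @ rs) = pverts (cone (disjoint_union ?Gs))"
      unfolding pverts_cone vG using rs by (auto simp: as_def)
    show "set (bs @ rs) = pverts (cone (disjoint_union ?Hs))"
      unfolding pverts_cone vH using rs by (auto simp: bs_def)
    show "(u, v) \<in> parcs (cone (disjoint_union ?Gs)) \<longleftrightarrow>
        (u, v) \<in> parcs (cone (disjoint_union ?Hs))" if "u \<in> set rs" "v \<in> set rs" for u v
      using that arcs_rest unfolding rs(1) by (auto simp: parcs_cone vG[simplified] vH[simplified])
    show "(u, a) \<in> parcs (cone (disjoint_union ?Gs)) \<longleftrightarrow>
        (u, b) \<in> parcs (cone (disjoint_union ?Hs))"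
      if "u \<in> set rs" "a \<in> set as" "b \<in> set bs" for u a b
    proof (cases u)
      case (Inl h)
      then show ?thesis
        using that rs(1) by (auto simp: parcs_cone vG[simplified] vH[simplified] as_def bs_def)
    next
      case (Inr p)
      then have "p \<in> S" using that rs(1) by auto
      with Inr show ?thesis
        using that by (auto simp: parcs_cone as_def bs_def disjoint_union_def S_def)
    qed
    show "claw_reflection \<in> carrier_mat 4 4"
      by (simp add: claw_reflection_def Let_def)
    show "claw_reflection * signless_laplacian (cone (disjoint_union ?Gs)) as =
        signless_laplacian (cone (disjoint_union ?Hs)) bs * claw_reflection"
      unfolding LG LH by (rule claw_reflection_conjugates)
  qed (use G H in \<open>auto simp: as_def bs_def claw_reflection_involution
        claw_reflection_row_sum claw_reflection_col_sum\<close>)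
qed

section \<open>Cones over cycles, edges and points\<close>

theorem theorem1p3:
  fixes t q s :: nat and k :: "nat \<Rightarrow> nat"
  assumes "t \<ge> 1" and "q \<ge> 1" and "s \<ge> 1"
    and "\<forall>i\<in>{1..t - 1}. k i \<ge> 3"
  shows "\<not> DQS (graph_join (complete_graph 1) (disjoint_union
             ([cycle_graph 3] @ map (\<lambda>i. cycle_graph (k i)) [1..<t]
               @ replicate q (complete_graph 2) @ replicate s (complete_graph 1)))) \<and>
         Q_cospectral
           (graph_join (complete_graph 1) (disjoint_union
             ([cycle_graph 3] @ map (\<lambda>i. cycle_graph (k i)) [1..<t]
               @ replicate q (complete_graph 2) @ replicate s (complete_graph 1))))
           (graph_join (complete_graph 1) (disjoint_union
             ([complete_bipartite_graph 1 3] @ map (\<lambda>i. cycle_graph (k i)) [1..<t]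
               @ replicate q (complete_graph 2) @ replicate (s - 1) (complete_graph 1))))"
proof -
  define Rs where "Rs = map (\<lambda>i. cycle_graph (k i)) [1..<t]
    @ replicate q (complete_graph 2) @ replicate (s - 1) (complete_graph 1)"
  let ?Gs = "[cycle_graph 3] @ map (\<lambda>i. cycle_graph (k i)) [1..<t]
    @ replicate q (complete_graph 2) @ replicate s (complete_graph 1)"
  let ?Hs = "[complete_bipartite_graph 1 3] @ map (\<lambda>i. cycle_graph (k i)) [1..<t]
    @ replicate q (complete_graph 2) @ replicate (s - 1) (complete_graph 1)"
  let ?G = "cone (disjoint_union ?Gs)" and ?H = "cone (disjoint_union ?Hs)"
  have Rs: "pair_graph R" if "R \<in> set Rs" for R
    using that assms(4)
    by (auto simp: Rs_def pair_graph_complete_graph intro!: pair_graph_cycle_graph)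
  have Hs_eq: "?Hs = [complete_bipartite_graph 1 3] @ Rs"
    by (simp add: Rs_def)
  have Gs_eq: "?Gs = [cycle_graph 3] @ Rs @ [complete_graph 1]"
    using assms(3) by (cases s) (simp_all add: Rs_def replicate_append_same)
  have cosp: "Q_cospectral ?G ?H"
    unfolding Gs_eq Hs_eq by (rule Q_cospectral_triangle_point_claw) (rule Rs)
  have Gs: "pair_graph K" if "K \<in> set ?Gs" for K
    using that Rs pair_graph_cycle_graph[of 3] pair_graph_complete_graph[of 1]
    unfolding Gs_eq by auto
  have Hs: "pair_graph K" if "K \<in> set ?Hs" for K
    using that Rs pair_graph_complete_bipartite_graph[of 1 3] unfolding Hs_eq by auto
  have H: "pair_graph ?H"
    using pair_graph_disjoint_union[of ?Hs] Hs
    by (blast intro: pair_graph_cone)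
  have small: "out_degree (with_proj K) v \<le> 2" if K: "K \<in> set ?Gs" and v: "v \<in> pverts K" for K v
  proof -
    consider n where "K = cycle_graph n" | "K = complete_graph 2" | "K = complete_graph 1"
      using K by auto
    then show ?thesis
    proof cases
      case 1
      then show ?thesis
        by (simp add: out_degree_cycle_graph_le)
    next
      case 2
      then show ?thesis
        using v out_degree_complete_graph[of v 2] by (simp add: complete_graph_def)
    next
      case 3
      then show ?thesis
        using v out_degree_complete_graph[of v 1] by (simp add: complete_graph_def)
    qed
  qed
  \<comment> \<open>The triangle and the first edge, which is the component with index \<open>t\<close>, give five vertices.\<close>
  have apex: "card (pverts (disjoint_union ?Gs)) \<ge> 5"
  proof -
    have "?Gs ! t = complete_graph 2"
      using assms(1,2) by (simp add: nth_append nth_Cons')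
    then have "{(0, 0), (0, 1), (0, 2), (t, 0), (t, 1)} \<subseteq> pverts (disjoint_union ?Gs)"
      using assms(1,2) by (auto simp: disjoint_union_def cycle_graph_def complete_graph_def)
    moreover have "finite (pverts (disjoint_union ?Gs))"
      using pair_graph_disjoint_union[of ?Gs, OF Gs] unfolding pair_graph_iff by blast
    ultimately have "card {(0::nat, 0::nat), (0, 1), (0, 2), (t, 0), (t, 1)} \<le>
        card (pverts (disjoint_union ?Gs))"
      by (intro card_mono)
    then show ?thesis
      using assms(1) by simp
  qed
  have no4: "out_degree (with_proj ?G) w \<noteq> 4" if w: "w \<in> pverts ?G" for w
  proof (cases "w = Inl 0")
    case True
    then show ?thesis
      using apex out_degree_cone_apex[of "disjoint_union ?Gs"] by simp
  next
    case False
    then obtain i v where w_eq: "w = Inr (i, v)" and i: "i < length ?Gs" "v \<in> pverts (?Gs ! i)"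
      using w unfolding pverts_cone disjoint_union_def by auto
    have "out_degree (with_proj ?G) w = Suc (out_degree (with_proj (?Gs ! i)) v)"
      unfolding w_eq by (rule out_degree_cone_disjoint_union[OF Gs i])
    also have "\<dots> \<le> 3"
      using small[OF nth_mem[OF i(1)] i(2)] by simp
    finally show ?thesis by simp
  qed
  have "\<not> digraph_iso (with_proj ?H) (with_proj ?G)"
  proof
    assume iso: "digraph_iso (with_proj ?H) (with_proj ?G)"
    have "Inr (0, 0) \<in> verts (with_proj ?H)"
      by (simp add: pverts_cone image_iff disjoint_union_def complete_bipartite_graph_def)
    then obtain w where "w \<in> verts (with_proj ?G)"
      "out_degree (with_proj ?G) w = out_degree (with_proj ?H) (Inr (0, 0))"
      using digraph_iso_out_degree[OF iso] by blast
    moreover have "out_degree (with_proj ?H) (Inr (0, 0)) = 4"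
      using out_degree_cone_disjoint_union[of ?Hs 0 0] Hs out_degree_star_centre[of 3]
      by simp (simp add: complete_bipartite_graph_def)
    ultimately show False
      using no4[of w] by simp
  qed
  moreover have "Q_cospectral ?H ?G"
    using cosp by (simp add: Q_cospectral_def)
  ultimately have "\<not> DQS ?G"
    using H by (intro not_DQS_if_Q_cospectral_not_iso)
  with cosp show ?thesis
    unfolding cone_def by blast
qed

end
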